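(* Let $\mathfrak h$, $\mathfrak g_1$, $\mathfrak g_2$ be topological Lie algebras, $V$ a topological $\mathfrak h$-module and $\omega\in Z^2(\mathfrak h,V)$ a continuous $2$-cocycle. Let $\zeta_j:\mathfrak g_j\to\mathrm{ham}(\mathfrak h,\omega)$, $j=1,2$, be two continuous Lie algebra homomorphisms and $J_j:\mathfrak g_j\to V$, $j=1,2$, corresponding momentum maps such that $J_2$ takes values in $V^{\mathfrak g_1}$. Then $J_1$ takes values in $V^{\mathfrak g_2}$ and $[\zeta_1(\mathfrak g_1),\zeta_2(\mathfrak g_2)]\subseteq\mathrm{rad}\,\omega$.
   Context: Cochains are continuous Chevalley–Eilenberg cochains with differential $d_{\mathfrak h}$; $(d_{\mathfrak h}v)(\xi)=\xi.v$; $i_\xi$ is insertion in the first argument. Since $\omega$ is a cocycle, $\mathrm{ham}(\mathfrak h,\omega)=\{\xi\in\mathfrak h:(\exists v\in V)\ i_\xi\omega=d_{\mathfrak h}v\}$. $\mathrm{rad}\,\omega=\{\xi\in\mathfrak h:i_\xi\omega=0\}$. $V^{\mathfrak g_j}=\{v\in V:(\forall X\in\mathfrak g_j)\ \zeta_j(X).v=0\}$. A momentum map for $\zeta_j$ is a continuous linear map $J_j:\mathfrak g_j\to V$ with $d_{\mathfrak h}(J_j(X))=i_{\zeta_j(X)}\omega$ for all $X\in\mathfrak g_j$ (so its values lie in $V_\omega=\{v\in V:(\exists\xi\in\mathrm{ham}(\mathfrak h,\omega))\ d_{\mathfrak h}v=i_\xi\omega\}$). *)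

theory Defs
  imports Complex_Main
begin

text \<open>
  All structures live on whole types over one scalar type \<open>'k :: real_normed_field\<close>, which covers
  both the real and the complex case. The class \<open>topological_ab_group_add\<close> supplies the
  continuity of the additive structure; no separation axiom is assumed. Continuity of maps of two
  arguments is always joint continuity, with respect to the product topology.
\<close>

locale topological_vector_space = vector_space scale
  for scale :: "'k::real_normed_field \<Rightarrow> 'a::topological_ab_group_add \<Rightarrow> 'a" +
  assumes continuous_scale: "continuous_on UNIV (\<lambda>(c, x). scale c x)"

definition bilinear_map ::
  "('k::field \<Rightarrow> 'a::ab_group_add \<Rightarrow> 'a) \<Rightarrow> ('k \<Rightarrow> 'b::ab_group_add \<Rightarrow> 'b) \<Rightarrow>
   ('k \<Rightarrow> 'c::ab_group_add \<Rightarrow> 'c) \<Rightarrow> ('a \<Rightarrow> 'b \<Rightarrow> 'c) \<Rightarrow> bool" where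
  "bilinear_map s1 s2 s3 b \<longleftrightarrow>
     (\<forall>x. Vector_Spaces.linear s2 s3 (\<lambda>y. b x y)) \<and>
     (\<forall>y. Vector_Spaces.linear s1 s3 (\<lambda>x. b x y))"

locale topological_lie_algebra = topological_vector_space scale
  for scale :: "'k::real_normed_field \<Rightarrow> 'a::topological_ab_group_add \<Rightarrow> 'a" +
  fixes bracket :: "'a \<Rightarrow> 'a \<Rightarrow> 'a"
  assumes bilinear_bracket: "bilinear_map scale scale scale bracket"
    and bracket_self: "bracket x x = 0"
    and jacobi: "bracket x (bracket y z) + bracket y (bracket z x) + bracket z (bracket x y) = 0"
    and continuous_bracket: "continuous_on UNIV (\<lambda>(x, y). bracket x y)"

locale topological_lie_module =
  topological_lie_algebra sh br + V: topological_vector_space sV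
  for sh :: "'k::real_normed_field \<Rightarrow> 'h::topological_ab_group_add \<Rightarrow> 'h"
    and br :: "'h \<Rightarrow> 'h \<Rightarrow> 'h"
    and sV :: "'k \<Rightarrow> 'v::topological_ab_group_add \<Rightarrow> 'v" +
  fixes act :: "'h \<Rightarrow> 'v \<Rightarrow> 'v"
  assumes bilinear_act: "bilinear_map sh sV sV act"
    and act_bracket: "act (br \<xi> \<eta>) v = act \<xi> (act \<eta> v) - act \<eta> (act \<xi> v)"
    and continuous_act: "continuous_on UNIV (\<lambda>(\<xi>, v). act \<xi> v)"

text \<open>
  Chevalley--Eilenberg cochains in low degree: a \<open>p\<close>-cochain is a curried function of \<open>p\<close> arguments,
  and \<open>d0\<close>, \<open>d2\<close> are the instances \<open>p = 0, 2\<close> of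
  \[ (d\omega)(\xi_0,\dots,\xi_p) =
     \sum_j (-1)^j \xi_j.\omega(\dots,\hat\xi_j,\dots)
     + \sum_{i<j} (-1)^{i+j} \omega([\xi_i,\xi_j],\dots,\hat\xi_i,\dots,\hat\xi_j,\dots). \]
\<close>

definition d0 :: "('h \<Rightarrow> 'v \<Rightarrow> 'v) \<Rightarrow> 'v \<Rightarrow> 'h \<Rightarrow> 'v" where
  "d0 act v = (\<lambda>\<xi>. act \<xi> v)"

definition d2 ::
  "('h \<Rightarrow> 'h \<Rightarrow> 'h) \<Rightarrow> ('h \<Rightarrow> 'v::ab_group_add \<Rightarrow> 'v) \<Rightarrow> ('h \<Rightarrow> 'h \<Rightarrow> 'v) \<Rightarrow>
   'h \<Rightarrow> 'h \<Rightarrow> 'h \<Rightarrow> 'v" where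
  "d2 br act \<omega> = (\<lambda>\<xi>0 \<xi>1 \<xi>2.
     act \<xi>0 (\<omega> \<xi>1 \<xi>2) - act \<xi>1 (\<omega> \<xi>0 \<xi>2) + act \<xi>2 (\<omega> \<xi>0 \<xi>1)
     - \<omega> (br \<xi>0 \<xi>1) \<xi>2 + \<omega> (br \<xi>0 \<xi>2) \<xi>1 - \<omega> (br \<xi>1 \<xi>2) \<xi>0)"

definition continuous_2_cochains ::
  "('k::field \<Rightarrow> 'h::{ab_group_add, topological_space} \<Rightarrow> 'h) \<Rightarrow>
   ('k \<Rightarrow> 'v::{ab_group_add, topological_space} \<Rightarrow> 'v) \<Rightarrow> ('h \<Rightarrow> 'h \<Rightarrow> 'v) set" where
  "continuous_2_cochains sh sV = {\<omega>. bilinear_map sh sh sV \<omega> \<and> (\<forall>\<xi>. \<omega> \<xi> \<xi> = 0) \<and>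
     continuous_on UNIV (\<lambda>(\<xi>, \<eta>). \<omega> \<xi> \<eta>)}"

definition continuous_2_cocycles ::
  "('k::field \<Rightarrow> 'h::{ab_group_add, topological_space} \<Rightarrow> 'h) \<Rightarrow> ('h \<Rightarrow> 'h \<Rightarrow> 'h) \<Rightarrow>
   ('k \<Rightarrow> 'v::{ab_group_add, topological_space} \<Rightarrow> 'v) \<Rightarrow> ('h \<Rightarrow> 'v \<Rightarrow> 'v) \<Rightarrow>
   ('h \<Rightarrow> 'h \<Rightarrow> 'v) set" where
  "continuous_2_cocycles sh br sV act =
     {\<omega> \<in> continuous_2_cochains sh sV. d2 br act \<omega> = (\<lambda>_ _ _. 0)}"

definition insertion :: "'h \<Rightarrow> ('h \<Rightarrow> 'h \<Rightarrow> 'v) \<Rightarrow> 'h \<Rightarrow> 'v" where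
  "insertion \<xi> \<omega> = (\<lambda>\<eta>. \<omega> \<xi> \<eta>)"

definition ham :: "('h \<Rightarrow> 'v \<Rightarrow> 'v) \<Rightarrow> ('h \<Rightarrow> 'h \<Rightarrow> 'v) \<Rightarrow> 'h set" where
  "ham act \<omega> = {\<xi>. \<exists>v. insertion \<xi> \<omega> = d0 act v}"

definition rad :: "('h \<Rightarrow> 'h \<Rightarrow> 'v::zero) \<Rightarrow> 'h set" where
  "rad \<omega> = {\<xi>. insertion \<xi> \<omega> = (\<lambda>_. 0)}"

text \<open>
  The subalgebra \<open>S\<close> carries the subspace topology, so continuity into \<open>S\<close> is continuity into the
  ambient Lie algebra.
\<close>

definition continuous_lie_hom_into ::
  "('k::field \<Rightarrow> 'g::{ab_group_add, topological_space} \<Rightarrow> 'g) \<Rightarrow> ('g \<Rightarrow> 'g \<Rightarrow> 'g) \<Rightarrow>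
   ('k \<Rightarrow> 'h::{ab_group_add, topological_space} \<Rightarrow> 'h) \<Rightarrow> ('h \<Rightarrow> 'h \<Rightarrow> 'h) \<Rightarrow>
   'h set \<Rightarrow> ('g \<Rightarrow> 'h) \<Rightarrow> bool" where
  "continuous_lie_hom_into sg brg sh brh S \<zeta> \<longleftrightarrow>
     Vector_Spaces.linear sg sh \<zeta> \<and> (\<forall>X Y. \<zeta> (brg X Y) = brh (\<zeta> X) (\<zeta> Y)) \<and>
     continuous_on UNIV \<zeta> \<and> range \<zeta> \<subseteq> S"

definition momentum_map ::
  "('k::field \<Rightarrow> 'g::{ab_group_add, topological_space} \<Rightarrow> 'g) \<Rightarrow>
   ('k \<Rightarrow> 'v::{ab_group_add, topological_space} \<Rightarrow> 'v) \<Rightarrow> ('h \<Rightarrow> 'v \<Rightarrow> 'v) \<Rightarrow>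
   ('h \<Rightarrow> 'h \<Rightarrow> 'v) \<Rightarrow> ('g \<Rightarrow> 'h) \<Rightarrow> ('g \<Rightarrow> 'v) \<Rightarrow> bool" where
  "momentum_map sg sV act \<omega> \<zeta> J \<longleftrightarrow>
     Vector_Spaces.linear sg sV J \<and> continuous_on UNIV J \<and>
     (\<forall>X. d0 act (J X) = insertion (\<zeta> X) \<omega>)"

definition invariants :: "('h \<Rightarrow> 'v::zero \<Rightarrow> 'v) \<Rightarrow> ('g \<Rightarrow> 'h) \<Rightarrow> 'v set" where
  "invariants act \<zeta> = {v. \<forall>X. act (\<zeta> X) v = 0}"

text \<open>For subsets \<open>A\<close>, \<open>B\<close> of a Lie algebra, \<open>[A, B]\<close> is the linear span of the brackets.\<close>

definition bracket_span ::
  "('k::field \<Rightarrow> 'h::ab_group_add \<Rightarrow> 'h) \<Rightarrow> ('h \<Rightarrow> 'h \<Rightarrow> 'h) \<Rightarrow> 'h set \<Rightarrow> 'h set \<Rightarrow> 'h set" where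
  "bracket_span sh br A B = module.span sh {br a b | a b. a \<in> A \<and> b \<in> B}"

end

theory Submission
  imports Defs
begin

text \<open>
  Write \<open>a = \<zeta>1 X\<close> and \<open>b = \<zeta>2 Y\<close>. Both \<open>J1 X\<close> and \<open>J2 Y\<close> are potentials of the
  corresponding contractions of \<open>\<omega>\<close>, so the single value \<open>\<omega> a b\<close> can be read off in two ways:
  it is \<open>b.(J1 X)\<close>, and by skew-symmetry it is \<open>- a.(J2 Y)\<close>. Hence the invariance of \<open>J2\<close> under
  the first algebra and that of \<open>J1\<close> under the second say the same thing, namely
  \<open>\<omega> (\<zeta>1 X) (\<zeta>2 Y) = 0\<close>.

  The inclusion in the radical comes from the fact that the bracket of two Hamiltonian elements
  \<open>a\<close>, \<open>b\<close> is again Hamiltonian, with potential \<open>\<omega> b a\<close> (lemma \<open>insertion_bracket_ham\<close>), as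
  for the Poisson bracket in symplectic geometry. In the present situation that potential vanishes,
  so every \<open>[\<zeta>1 X, \<zeta>2 Y]\<close> lies in \<open>rad \<omega>\<close>; as \<open>rad \<omega>\<close> is a subspace, so does the span.
\<close>

lemma bilinear_map_zero_left:
  assumes "bilinear_map s1 s2 s3 b"
  shows "b 0 y = 0"
  using assms module_hom.zero[of s1 s3 "\<lambda>x. b x y"]
  by (simp add: bilinear_map_def linear_iff_module_hom)

lemma bilinear_map_add_left:
  assumes "bilinear_map s1 s2 s3 b"
  shows "b (x + x') y = b x y + b x' y"
  using assms module_hom.add[of s1 s3 "\<lambda>x. b x y"]
  by (simp add: bilinear_map_def linear_iff_module_hom)

lemma bilinear_map_add_right:
  assumes "bilinear_map s1 s2 s3 b"
  shows "b x (y + y') = b x y + b x y'"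
  using assms module_hom.add[of s2 s3 "\<lambda>y. b x y"]
  by (simp add: bilinear_map_def linear_iff_module_hom)

lemma bilinear_map_scale_left:
  assumes "bilinear_map s1 s2 s3 b"
  shows "b (s1 c x) y = s3 c (b x y)"
  using assms module_hom.scale[of s1 s3 "\<lambda>x. b x y"]
  by (simp add: bilinear_map_def linear_iff_module_hom)

lemma bilinear_map_zero_right:
  assumes "bilinear_map s1 s2 s3 b"
  shows "b x 0 = 0"
  using assms module_hom.zero[of s2 s3 "\<lambda>y. b x y"]
  by (simp add: bilinear_map_def linear_iff_module_hom)

lemma bilinear_map_minus_right:
  assumes "bilinear_map s1 s2 s3 b"
  shows "b x (- y) = - b x y"
  using assms module_hom.neg[of s2 s3 "\<lambda>y. b x y"]
  by (simp add: bilinear_map_def linear_iff_module_hom)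

lemma cochain_skew:
  assumes "\<omega> \<in> continuous_2_cochains sh sV"
  shows "\<omega> x y = - \<omega> y x"
proof -
  have bil: "bilinear_map sh sh sV \<omega>" and alt: "\<And>z. \<omega> z z = 0"
    using assms by (auto simp: continuous_2_cochains_def)
  have "\<omega> (x + y) (x + y) = (\<omega> x x + \<omega> y x) + (\<omega> x y + \<omega> y y)"
    by (simp only: bilinear_map_add_left[OF bil] bilinear_map_add_right[OF bil])
  then have "\<omega> x y + \<omega> y x = 0"
    unfolding alt by (simp add: add.commute)
  then show ?thesis
    by (simp add: eq_neg_iff_add_eq_0)
qed

lemma subspace_rad:
  assumes "\<omega> \<in> continuous_2_cochains sh sV" and "vector_space sh" and "vector_space sV"
  shows "module.subspace sh (rad \<omega>)"
proof -
  interpret H: vector_space sh by fact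
  interpret V: vector_space sV by fact
  have bil: "bilinear_map sh sh sV \<omega>"
    using assms(1) by (simp add: continuous_2_cochains_def)
  show ?thesis
    by (rule H.subspaceI)
      (auto simp: rad_def insertion_def fun_eq_iff bilinear_map_zero_left[OF bil]
        bilinear_map_add_left[OF bil] bilinear_map_scale_left[OF bil])
qed

text \<open>
  Evaluate the cocycle identity at \<open>(a, b, \<eta>)\<close> and replace each contraction of \<open>\<omega>\<close> with \<open>a\<close> or
  \<open>b\<close> by the action on the potential \<open>v\<close> or \<open>w\<close>. The module axiom splits \<open>[a, \<eta>].w\<close> and
  \<open>[b, \<eta>].v\<close>, the second-order terms \<open>a.\<eta>.w\<close> and \<open>b.\<eta>.v\<close> cancel, and what is left consists of
  \<open>[a, b]\<close> contracted with \<open>\<omega>\<close> and three multiples of \<open>\<eta>.(\<omega> a b)\<close> with signs \<open>+\<close>, \<open>-\<close>, \<open>-\<close>.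
\<close>
lemma insertion_bracket_ham:
  assumes module: "topological_lie_module sh brh sV act"
    and cocycle: "\<omega> \<in> continuous_2_cocycles sh brh sV act"
    and v: "d0 act v = insertion a \<omega>" and w: "d0 act w = insertion b \<omega>"
  shows "insertion (brh a b) \<omega> = d0 act (\<omega> b a)"
proof
  fix \<eta>
  interpret topological_lie_module sh brh sV act by fact
  have cochain: "\<omega> \<in> continuous_2_cochains sh sV"
    using cocycle by (simp add: continuous_2_cocycles_def)
  note skew = cochain_skew[OF cochain]
  have \<omega>a: "\<omega> a \<xi> = act \<xi> v" and \<omega>b: "\<omega> b \<xi> = act \<xi> w" for \<xi>
    using v w by (simp_all add: d0_def insertion_def fun_eq_iff)
  have closed: "act a (\<omega> b \<eta>) - act b (\<omega> a \<eta>) + act \<eta> (\<omega> a b)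
      - \<omega> (brh a b) \<eta> + \<omega> (brh a \<eta>) b - \<omega> (brh b \<eta>) a = 0"
    using cocycle by (simp add: continuous_2_cocycles_def d2_def fun_eq_iff)
  have ab: "act \<eta> (\<omega> a b) = - act \<eta> (\<omega> b a)"
    using skew[of a b] by (simp add: bilinear_map_minus_right[OF bilinear_act])
  have "\<omega> (brh a \<eta>) b = - act (brh a \<eta>) w"
    using skew[of "brh a \<eta>" b] by (simp add: \<omega>b)
  also have "\<dots> = act \<eta> (\<omega> b a) - act a (\<omega> b \<eta>)"
    by (simp add: act_bracket \<omega>b)
  finally have a\<eta>: "\<omega> (brh a \<eta>) b = act \<eta> (\<omega> b a) - act a (\<omega> b \<eta>)" .
  have "\<omega> (brh b \<eta>) a = - act (brh b \<eta>) v"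
    using skew[of "brh b \<eta>" a] by (simp add: \<omega>a)
  also have "\<dots> = act \<eta> (\<omega> a b) - act b (\<omega> a \<eta>)"
    by (simp add: act_bracket \<omega>a)
  finally have b\<eta>: "\<omega> (brh b \<eta>) a = - act \<eta> (\<omega> b a) - act b (\<omega> a \<eta>)"
    by (simp add: ab)
  show "insertion (brh a b) \<omega> \<eta> = d0 act (\<omega> b a) \<eta>"
    using closed by (simp add: insertion_def d0_def ab a\<eta> b\<eta> algebra_simps)
qed

theorem proposition5p2:
  fixes sh :: "'k::real_normed_field \<Rightarrow> 'h::topological_ab_group_add \<Rightarrow> 'h"
    and brh :: "'h \<Rightarrow> 'h \<Rightarrow> 'h"
    and s1 :: "'k \<Rightarrow> 'g1::topological_ab_group_add \<Rightarrow> 'g1"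
    and br1 :: "'g1 \<Rightarrow> 'g1 \<Rightarrow> 'g1"
    and s2 :: "'k \<Rightarrow> 'g2::topological_ab_group_add \<Rightarrow> 'g2"
    and br2 :: "'g2 \<Rightarrow> 'g2 \<Rightarrow> 'g2"
    and sV :: "'k \<Rightarrow> 'v::topological_ab_group_add \<Rightarrow> 'v"
    and act :: "'h \<Rightarrow> 'v \<Rightarrow> 'v"
    and \<omega> :: "'h \<Rightarrow> 'h \<Rightarrow> 'v"
    and \<zeta>1 :: "'g1 \<Rightarrow> 'h" and \<zeta>2 :: "'g2 \<Rightarrow> 'h"
    and J1 :: "'g1 \<Rightarrow> 'v" and J2 :: "'g2 \<Rightarrow> 'v"
  assumes "topological_lie_algebra sh brh"
    and "topological_lie_algebra s1 br1"
    and "topological_lie_algebra s2 br2"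
    and "topological_lie_module sh brh sV act"
    and "\<omega> \<in> continuous_2_cocycles sh brh sV act"
    and "continuous_lie_hom_into s1 br1 sh brh (ham act \<omega>) \<zeta>1"
    and "continuous_lie_hom_into s2 br2 sh brh (ham act \<omega>) \<zeta>2"
    and "momentum_map s1 sV act \<omega> \<zeta>1 J1"
    and "momentum_map s2 sV act \<omega> \<zeta>2 J2"
    and "range J2 \<subseteq> invariants act \<zeta>1"
  shows "range J1 \<subseteq> invariants act \<zeta>2 \<and>
    bracket_span sh brh (range \<zeta>1) (range \<zeta>2) \<subseteq> rad \<omega>"
proof -
  interpret M: topological_lie_module sh brh sV act by fact
  have cochain: "\<omega> \<in> continuous_2_cochains sh sV"
    using assms(5) by (simp add: continuous_2_cocycles_def)
  have J1: "d0 act (J1 X) = insertion (\<zeta>1 X) \<omega>" for X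
    using assms(8) by (simp add: momentum_map_def)
  have J2: "d0 act (J2 Y) = insertion (\<zeta>2 Y) \<omega>" for Y
    using assms(9) by (simp add: momentum_map_def)
  have \<omega>21: "\<omega> (\<zeta>2 Y) (\<zeta>1 X) = 0" for X Y
  proof -
    have "\<omega> (\<zeta>2 Y) (\<zeta>1 X) = act (\<zeta>1 X) (J2 Y)"
      using fun_cong[OF J2] by (simp add: d0_def insertion_def)
    also have "\<dots> = 0"
      using assms(10) by (auto simp: invariants_def)
    finally show ?thesis .
  qed
  have "act (\<zeta>2 Y) (J1 X) = 0" for X Y
  proof -
    have "act (\<zeta>2 Y) (J1 X) = \<omega> (\<zeta>1 X) (\<zeta>2 Y)"
      using fun_cong[OF J1] by (simp add: d0_def insertion_def)
    also have "\<dots> = - \<omega> (\<zeta>2 Y) (\<zeta>1 X)"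
      by (rule cochain_skew[OF cochain])
    finally show ?thesis
      by (simp add: \<omega>21)
  qed
  then have inv: "range J1 \<subseteq> invariants act \<zeta>2"
    by (auto simp: invariants_def)
  have "brh (\<zeta>1 X) (\<zeta>2 Y) \<in> rad \<omega>" for X Y
    using insertion_bracket_ham[OF assms(4,5) J1 J2, of X Y]
    by (simp add: rad_def d0_def \<omega>21 bilinear_map_zero_right[OF M.bilinear_act])
  then have "bracket_span sh brh (range \<zeta>1) (range \<zeta>2) \<subseteq> rad \<omega>"
    unfolding bracket_span_def
    by (intro M.span_minimal subspace_rad[OF cochain M.vector_space_axioms
          M.V.vector_space_axioms]) auto
  with inv show ?thesis ..
qed

end
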